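(* Let $\mathbb{K}$ be an algebraically closed field of characteristic zero and let $X$ be a strict affine ind-variety over $\mathbb{K}$. Then the coordinate ring $\mathcal{O}(X)$ is not noetherian, and it does not have a countable set of generators as a $\mathbb{K}$-algebra.
   Context: All algebraic varieties are over $\mathbb{K}$. An ind-variety is a set $X$ together with an ascending filtration $X_0\subseteq X_1\subseteq X_2\subseteq\dots\subseteq X$ such that $X=\bigcup_{k}X_k$, each $X_k$ has the structure of an algebraic variety, and each inclusion $X_k\subseteq X_{k+1}$ is a closed immersion of algebraic varieties. A morphism of ind-varieties $X=\bigcup X_i\to Y=\bigcup Y_j$ is a map $\varphi:X\to Y$ such that for every $k$ there is $l=l(k)$ with $\varphi(X_k)\subseteq Y_l$ and the induced map $X_k\to Y_l$ is a morphism of varieties; an isomorphism is a bijective morphism whose inverse is also a morphism. Filtrations of $X$ are considered up to equivalence, i.e. two filtrations are identified if the identity map is an isomorphism between them. An ind-variety is affine if it admits a filtration in which all $X_k$ are affine. For an affine ind-variety with such a filtration, the coordinate ring (algebra of regular functions) is $\mathcal{O}(X)=\varprojlim\mathcal{O}(X_k)$, the inverse limit along the (surjective) restriction maps $\mathcal{O}(X_{k})\to\mathcal{O}(X_m)$, $k\ge m$. An algebraic variety is viewed as an ind-variety with a constant (finite) filtration. An affine ind-variety is called strict if it is not isomorphic, as an ind-variety, to an algebraic variety, i.e. it does not have a finite filtration by affine algebraic varieties. *)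

theory Defs
  imports "HOL-Algebra.Module" "HOL-Algebra.Ring_Divisibility"
    "HOL-Computational_Algebra.Polynomial" "HOL-Library.Countable_Set"
begin

section \<open>Affine varieties\<close>

text \<open>
  An affine variety is presented by its set of points and its ring of regular functions.
  Regular functions are kept extensional, that is, \<^term>\<open>undefined\<close> off the set of points.
  Varieties are not assumed to be irreducible.
\<close>

record ('x, 'k) variety =
  points :: "'x set"
  regular :: "('x \<Rightarrow> 'k) set"

definition morphism :: "('x, 'k) variety \<Rightarrow> ('y, 'k) variety \<Rightarrow> ('x \<Rightarrow> 'y) \<Rightarrow> bool" where
  "morphism V W f \<longleftrightarrow> f ` points V \<subseteq> points W \<and>
     (\<forall>g\<in>regular W. restrict (\<lambda>x. g (f x)) (points V) \<in> regular V)"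

definition isomorphism :: "('x, 'k) variety \<Rightarrow> ('y, 'k) variety \<Rightarrow> ('x \<Rightarrow> 'y) \<Rightarrow> bool" where
  "isomorphism V W f \<longleftrightarrow> bij_betw f (points V) (points W) \<and> morphism V W f \<and>
     morphism W V (inv_into (points V) f)"

definition zero_locus :: "('x, 'k::field) variety \<Rightarrow> ('x \<Rightarrow> 'k) set \<Rightarrow> 'x set" where
  "zero_locus V F = {x \<in> points V. \<forall>f\<in>F. f x = 0}"

definition zariski_closed :: "('x, 'k::field) variety \<Rightarrow> 'x set \<Rightarrow> bool" where
  "zariski_closed V Z \<longleftrightarrow> (\<exists>F\<subseteq>regular V. Z = zero_locus V F)"

text \<open>The reduced structure on a closed subset \<open>Z\<close>.\<close>

definition subvariety :: "('x, 'k) variety \<Rightarrow> 'x set \<Rightarrow> ('x, 'k) variety" where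
  "subvariety V Z = \<lparr>points = Z, regular = (\<lambda>f. restrict f Z) ` regular V\<rparr>"

definition closed_immersion ::
    "('x, 'k::field) variety \<Rightarrow> ('y, 'k) variety \<Rightarrow> ('x \<Rightarrow> 'y) \<Rightarrow> bool" where
  "closed_immersion V W f \<longleftrightarrow> zariski_closed W (f ` points V) \<and>
     isomorphism V (subvariety W (f ` points V)) f"

text \<open>Here \<open>m\<close> runs through finitely many exponent vectors.\<close>

definition polynomial_function :: "nat \<Rightarrow> ((nat \<Rightarrow> 'k::field) \<Rightarrow> 'k) \<Rightarrow> bool" where
  "polynomial_function n f \<longleftrightarrow>
     (\<exists>(M :: (nat \<Rightarrow> nat) set) c. finite M \<and> f = (\<lambda>p. \<Sum>m\<in>M. c m * (\<Prod>i<n. p i ^ m i)))"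

text \<open>A point of \<open>n\<close>-space is a sequence vanishing from index \<open>n\<close> on.\<close>

definition affine_space :: "nat \<Rightarrow> (nat \<Rightarrow> 'k::field, 'k) variety" where
  "affine_space n = (let P = {p. \<forall>i\<ge>n. p i = 0}
     in \<lparr>points = P, regular = {restrict f P |f. polynomial_function n f}\<rparr>)"

definition affine_variety :: "('x, 'k::field) variety \<Rightarrow> bool" where
  "affine_variety V \<longleftrightarrow> regular V \<subseteq> extensional (points V) \<and>
     (\<exists>n Z f. zariski_closed (affine_space n) Z \<and>
        isomorphism V (subvariety (affine_space n) Z) f)"


section \<open>Affine ind-varieties\<close>

text \<open>
  An affine ind-variety is given by a filtration by affine varieties; its underlying set is the
  union of the filtration.
\<close>

definition affine_ind_variety :: "(nat \<Rightarrow> ('x, 'k::field) variety) \<Rightarrow> bool" where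
  "affine_ind_variety X \<longleftrightarrow> (\<forall>k. affine_variety (X k)) \<and>
     (\<forall>k. points (X k) \<subseteq> points (X (Suc k)) \<and> closed_immersion (X k) (X (Suc k)) (\<lambda>x. x))"

definition ind_points :: "(nat \<Rightarrow> ('x, 'k) variety) \<Rightarrow> 'x set" where
  "ind_points X = (\<Union>k. points (X k))"

definition ind_morphism ::
    "(nat \<Rightarrow> ('x, 'k) variety) \<Rightarrow> (nat \<Rightarrow> ('y, 'k) variety) \<Rightarrow> ('x \<Rightarrow> 'y) \<Rightarrow> bool" where
  "ind_morphism X Y f \<longleftrightarrow> (\<forall>k. \<exists>l. morphism (X k) (Y l) f)"

definition ind_isomorphism ::
    "(nat \<Rightarrow> ('x, 'k) variety) \<Rightarrow> (nat \<Rightarrow> ('y, 'k) variety) \<Rightarrow> ('x \<Rightarrow> 'y) \<Rightarrow> bool" where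
  "ind_isomorphism X Y f \<longleftrightarrow> bij_betw f (ind_points X) (ind_points Y) \<and> ind_morphism X Y f \<and>
     ind_morphism Y X (inv_into (ind_points X) f)"

definition equivalent_filtrations ::
    "(nat \<Rightarrow> ('x, 'k) variety) \<Rightarrow> (nat \<Rightarrow> ('x, 'k) variety) \<Rightarrow> bool" where
  "equivalent_filtrations X Y \<longleftrightarrow> ind_points X = ind_points Y \<and> ind_isomorphism X Y (\<lambda>x. x)"

text \<open>
  Strict: there is no finite, that is, eventually constant, filtration by affine varieties.
  Equivalently, the ind-variety is not isomorphic to an affine variety with its constant
  filtration; see \<open>strict_not_isomorphic\<close> and \<open>not_strict_isomorphic\<close> below.
\<close>

definition strict :: "(nat \<Rightarrow> ('x, 'k::field) variety) \<Rightarrow> bool" where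
  "strict X \<longleftrightarrow> \<not> (\<exists>Y N. affine_ind_variety Y \<and> (\<forall>k\<ge>N. Y k = Y N) \<and>
     equivalent_filtrations X Y)"


section \<open>Coordinate algebras\<close>

definition regular_algebra :: "('x, 'k::field) variety \<Rightarrow> ('k, 'x \<Rightarrow> 'k) module" where
  "regular_algebra V =
     \<lparr>carrier = regular V,
      monoid.mult = (\<lambda>f g. \<lambda>x\<in>points V. f x * g x),
      one = (\<lambda>x\<in>points V. 1),
      zero = (\<lambda>x\<in>points V. 0),
      add = (\<lambda>f g. \<lambda>x\<in>points V. f x + g x),
      module.smult = (\<lambda>c f. \<lambda>x\<in>points V. c * f x)\<rparr>"

text \<open>The transition map \<open>r k m\<close>, for \<open>m \<le> k\<close>, goes from \<open>A k\<close> to \<open>A m\<close>.\<close>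

definition inverse_limit ::
    "(nat \<Rightarrow> ('k, 'a) module) \<Rightarrow> (nat \<Rightarrow> nat \<Rightarrow> 'a \<Rightarrow> 'a) \<Rightarrow> ('k, nat \<Rightarrow> 'a) module" where
  "inverse_limit A r =
     \<lparr>carrier = {s. (\<forall>k. s k \<in> carrier (A k)) \<and> (\<forall>k m. m \<le> k \<longrightarrow> r k m (s k) = s m)},
      monoid.mult = (\<lambda>s t k. s k \<otimes>\<^bsub>A k\<^esub> t k),
      one = (\<lambda>k. \<one>\<^bsub>A k\<^esub>),
      zero = (\<lambda>k. \<zero>\<^bsub>A k\<^esub>),
      add = (\<lambda>s t k. s k \<oplus>\<^bsub>A k\<^esub> t k),
      module.smult = (\<lambda>c s k. c \<odot>\<^bsub>A k\<^esub> s k)\<rparr>"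

definition coordinate_ring ::
    "(nat \<Rightarrow> ('x, 'k::field) variety) \<Rightarrow> ('k, nat \<Rightarrow> 'x \<Rightarrow> 'k) module" where
  "coordinate_ring X =
     inverse_limit (\<lambda>k. regular_algebra (X k)) (\<lambda>k m f. restrict f (points (X m)))"

inductive_set generated_subalgebra :: "('k, 'a) module \<Rightarrow> 'a set \<Rightarrow> 'a set"
  for A :: "('k, 'a) module" and S :: "'a set" where
  one: "\<one>\<^bsub>A\<^esub> \<in> generated_subalgebra A S"
| incl: "s \<in> S \<Longrightarrow> s \<in> generated_subalgebra A S"
| add: "\<lbrakk>a \<in> generated_subalgebra A S; b \<in> generated_subalgebra A S\<rbrakk>
        \<Longrightarrow> a \<oplus>\<^bsub>A\<^esub> b \<in> generated_subalgebra A S"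
| mult: "\<lbrakk>a \<in> generated_subalgebra A S; b \<in> generated_subalgebra A S\<rbrakk>
        \<Longrightarrow> a \<otimes>\<^bsub>A\<^esub> b \<in> generated_subalgebra A S"
| smult: "a \<in> generated_subalgebra A S \<Longrightarrow> c \<odot>\<^bsub>A\<^esub> a \<in> generated_subalgebra A S"

definition countably_generated_algebra :: "('k, 'a) module \<Rightarrow> bool" where
  "countably_generated_algebra A \<longleftrightarrow>
     (\<exists>S. countable S \<and> S \<subseteq> carrier A \<and> generated_subalgebra A S = carrier A)"


section \<open>The coordinate ring is a commutative algebra\<close>

lemma polynomial_function_iff:
  "polynomial_function n f \<longleftrightarrow>
     (\<exists>(I :: nat set) c e. finite I \<and> f = (\<lambda>p. \<Sum>j\<in>I. c j * (\<Prod>i<n. p i ^ e j i)))"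
proof
  assume "polynomial_function n f"
  then obtain M c where M: "finite (M :: (nat \<Rightarrow> nat) set)"
    and f: "f = (\<lambda>p. \<Sum>m\<in>M. c m * (\<Prod>i<n. p i ^ m i))"
    by (auto simp: polynomial_function_def)
  obtain h where h: "bij_betw h {0..<card M} M"
    using ex_bij_betw_nat_finite[OF M] by blast
  show "\<exists>(I :: nat set) c e. finite I \<and> f = (\<lambda>p. \<Sum>j\<in>I. c j * (\<Prod>i<n. p i ^ e j i))"
    by (rule exI[of _ "{0..<card M}"], rule exI[of _ "\<lambda>j. c (h j)"], rule exI[of _ h])
      (simp add: f sum.reindex_bij_betw[OF h, where g = "\<lambda>m. c m * (\<Prod>i<n. _ i ^ m i)"])
next
  assume "\<exists>(I :: nat set) c e. finite I \<and> f = (\<lambda>p. \<Sum>j\<in>I. c j * (\<Prod>i<n. p i ^ e j i))"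
  then obtain I :: "nat set" and c e where I: "finite I"
    and f: "f = (\<lambda>p. \<Sum>j\<in>I. c j * (\<Prod>i<n. p i ^ e j i))" by blast
  have "(\<Sum>j\<in>I. c j * (\<Prod>i<n. p i ^ e j i))
      = (\<Sum>m\<in>e ` I. (\<Sum>j\<in>{j\<in>I. e j = m}. c j) * (\<Prod>i<n. p i ^ m i))" for p
    by (simp add: sum.image_gen[OF I, of _ e] sum_distrib_right)
  then show "polynomial_function n f"
    unfolding polynomial_function_def f using I
    by (intro exI[of _ "e ` I"] exI[of _ "\<lambda>m. \<Sum>j\<in>{j\<in>I. e j = m}. c j"]) auto
qed

lemma polynomial_functionI:
  assumes "finite J" "\<And>p. f p = (\<Sum>j\<in>J. c j * (\<Prod>i<n. p i ^ e j i))"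
  shows "polynomial_function n f"
proof -
  obtain h where h: "bij_betw h {0..<card J} J"
    using ex_bij_betw_nat_finite[OF assms(1)] by blast
  show ?thesis
    unfolding polynomial_function_iff
    by (rule exI[of _ "{0..<card J}"], rule exI[of _ "\<lambda>j. c (h j)"],
        rule exI[of _ "\<lambda>j. e (h j)"])
      (auto simp: assms(2) fun_eq_iff
        sum.reindex_bij_betw[OF h, where g = "\<lambda>j. c j * (\<Prod>i<n. _ i ^ e j i)"])
qed

lemma polynomial_function_const: "polynomial_function n (\<lambda>_. c)"
  by (rule polynomial_functionI[where J = "{()}" and c = "\<lambda>_. c" and e = "\<lambda>_ _. 0"]) auto

lemma polynomial_function_add:
  assumes "polynomial_function n f" "polynomial_function n g"
  shows "polynomial_function n (\<lambda>p. f p + g p)"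
proof -
  obtain M :: "(nat \<Rightarrow> nat) set" and c where M: "finite M"
    "f = (\<lambda>p. \<Sum>m\<in>M. c m * (\<Prod>i<n. p i ^ m i))"
    using assms(1) by (auto simp: polynomial_function_def)
  obtain N :: "(nat \<Rightarrow> nat) set" and d where N: "finite N"
    "g = (\<lambda>p. \<Sum>m\<in>N. d m * (\<Prod>i<n. p i ^ m i))"
    using assms(2) by (auto simp: polynomial_function_def)
  show ?thesis
    by (rule polynomial_functionI[where J = "Sum_Type.Plus M N" and c = "case_sum c d"
          and e = "case_sum id id"])
      (use M N in \<open>auto simp: sum.Plus\<close>)
qed

lemma polynomial_function_mult:
  assumes "polynomial_function n f" "polynomial_function n g"
  shows "polynomial_function n (\<lambda>p. f p * g p)"
proof -
  obtain M :: "(nat \<Rightarrow> nat) set" and c where M: "finite M"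
    "f = (\<lambda>p. \<Sum>m\<in>M. c m * (\<Prod>i<n. p i ^ m i))"
    using assms(1) by (auto simp: polynomial_function_def)
  obtain N :: "(nat \<Rightarrow> nat) set" and d where N: "finite N"
    "g = (\<lambda>p. \<Sum>m\<in>N. d m * (\<Prod>i<n. p i ^ m i))"
    using assms(2) by (auto simp: polynomial_function_def)
  show ?thesis
    by (rule polynomial_functionI[where J = "M \<times> N" and c = "\<lambda>(a, b). c a * d b"
          and e = "\<lambda>(a, b) i. a i + b i"])
      (use M N in \<open>auto simp: sum_product sum.cartesian_product power_add prod.distrib
        algebra_simps intro!: sum.cong\<close>)
qed

lemma affine_variety_regular:
  assumes "affine_variety V"
  obtains n f where "regular V = {restrict (\<lambda>x. p (f x)) (points V) |p. polynomial_function n p}"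
proof -
  obtain n Z f where ext: "regular V \<subseteq> extensional (points V)"
    and Z: "zariski_closed (affine_space n) Z"
    and f: "isomorphism V (subvariety (affine_space n) Z) f"
    using assms by (auto simp: affine_variety_def)
  let ?W = "subvariety (affine_space n) Z"
  have bij: "bij_betw f (points V) Z"
    using f by (simp add: isomorphism_def subvariety_def)
  have ZP: "Z \<subseteq> {p. \<forall>i\<ge>n. p i = 0}"
    using Z by (auto simp: zariski_closed_def zero_locus_def affine_space_def Let_def)
  have regW: "regular ?W = {restrict p Z |p. polynomial_function n p}"
  proof -
    have "restrict (restrict p {p. \<forall>i\<ge>n. p i = 0}) Z = restrict p Z" for p :: "(nat \<Rightarrow> 'b) \<Rightarrow> 'b"
      using ZP by (auto simp: fun_eq_iff restrict_def)
    then show ?thesis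
      by (simp add: subvariety_def affine_space_def Let_def setcompr_eq_image image_image)
  qed
  have "regular V = {restrict (\<lambda>x. p (f x)) (points V) |p. polynomial_function n p}"
  proof (intro equalityI subsetI)
    fix g assume g: "g \<in> regular V"
    have "restrict (\<lambda>y. g (inv_into (points V) f y)) Z \<in> regular ?W"
      using f g by (simp add: isomorphism_def morphism_def subvariety_def)
    then obtain p where p: "polynomial_function n p"
      "restrict (\<lambda>y. g (inv_into (points V) f y)) Z = restrict p Z"
      unfolding regW by auto
    have "g = restrict (\<lambda>x. p (f x)) (points V)"
    proof
      fix x show "g x = restrict (\<lambda>x. p (f x)) (points V) x"
      proof (cases "x \<in> points V")
        case True
        then have "f x \<in> Z" "inv_into (points V) f (f x) = x"
          using bij by (auto simp: bij_betw_def)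
        then show ?thesis using True fun_cong[OF p(2), of "f x"] by simp
      next
        case False
        then show ?thesis using ext g by (auto simp: extensional_def)
      qed
    qed
    with p(1) show "g \<in> {restrict (\<lambda>x. p (f x)) (points V) |p. polynomial_function n p}" by blast
  next
    fix g assume "g \<in> {restrict (\<lambda>x. p (f x)) (points V) |p. polynomial_function n p}"
    then obtain p where p: "polynomial_function n p"
      and g: "g = restrict (\<lambda>x. p (f x)) (points V)" by blast
    have "restrict (\<lambda>x. restrict p Z (f x)) (points V) \<in> regular V"
      using f p(1) regW by (auto simp: isomorphism_def morphism_def)
    moreover have "restrict (\<lambda>x. restrict p Z (f x)) (points V) = g"
      using bij by (auto simp: g fun_eq_iff restrict_def bij_betw_def)
    ultimately show "g \<in> regular V" by simp
  qed
  then show ?thesis by (rule that)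
qed

lemma affine_variety_regular_closed:
  assumes "affine_variety V"
  shows "(\<lambda>x\<in>points V. c) \<in> regular V"
    and "\<lbrakk>g \<in> regular V; h \<in> regular V\<rbrakk> \<Longrightarrow> (\<lambda>x\<in>points V. g x + h x) \<in> regular V"
    and "\<lbrakk>g \<in> regular V; h \<in> regular V\<rbrakk> \<Longrightarrow> (\<lambda>x\<in>points V. g x * h x) \<in> regular V"
    and "g \<in> regular V \<Longrightarrow> (\<lambda>x\<in>points V. c * g x) \<in> regular V"
proof -
  obtain n f where R:
    "regular V = {restrict (\<lambda>x. p (f x)) (points V) |p. polynomial_function n p}"
    using affine_variety_regular[OF assms] .
  show const: "(\<lambda>x\<in>points V. c) \<in> regular V" for c
    unfolding R using polynomial_function_const[of n c] by (auto intro!: exI[of _ "\<lambda>_. c"])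
  show "(\<lambda>x\<in>points V. g x + h x) \<in> regular V" if "g \<in> regular V" "h \<in> regular V"
  proof -
    obtain p q where pq: "polynomial_function n p" "polynomial_function n q"
      and gh: "g = restrict (\<lambda>x. p (f x)) (points V)" "h = restrict (\<lambda>x. q (f x)) (points V)"
      using \<open>g \<in> _\<close> \<open>h \<in> _\<close> unfolding R by auto
    from pq have "polynomial_function n (\<lambda>y. p y + q y)" by (intro polynomial_function_add)
    moreover have "(\<lambda>x\<in>points V. g x + h x) = restrict (\<lambda>x. p (f x) + q (f x)) (points V)"
      by (auto simp: gh fun_eq_iff restrict_def)
    ultimately show ?thesis unfolding R
      by (intro CollectI exI[of _ "\<lambda>y. p y + q y"] conjI)
  qed
  show mult: "(\<lambda>x\<in>points V. g x * h x) \<in> regular V" if "g \<in> regular V" "h \<in> regular V" for g h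
  proof -
    obtain p q where pq: "polynomial_function n p" "polynomial_function n q"
      and gh: "g = restrict (\<lambda>x. p (f x)) (points V)" "h = restrict (\<lambda>x. q (f x)) (points V)"
      using \<open>g \<in> _\<close> \<open>h \<in> _\<close> unfolding R by auto
    from pq have "polynomial_function n (\<lambda>y. p y * q y)" by (intro polynomial_function_mult)
    moreover have "(\<lambda>x\<in>points V. g x * h x) = restrict (\<lambda>x. p (f x) * q (f x)) (points V)"
      by (auto simp: gh fun_eq_iff restrict_def)
    ultimately show ?thesis unfolding R
      by (intro CollectI exI[of _ "\<lambda>y. p y * q y"] conjI)
  qed
  show "(\<lambda>x\<in>points V. c * g x) \<in> regular V" if "g \<in> regular V"
  proof -
    have "(\<lambda>x\<in>points V. (\<lambda>x\<in>points V. c) x * g x) = (\<lambda>x\<in>points V. c * g x)"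
      by (auto simp: fun_eq_iff restrict_def)
    with mult[OF const[of c] that] show ?thesis by simp
  qed
qed

definition field_ring :: "'k::field ring" where
  "field_ring = \<lparr>carrier = UNIV, monoid.mult = (*), one = 1, zero = 0, add = (+)\<rparr>"

lemma cring_field_ring: "cring (field_ring :: 'k::field ring)"
proof (rule cringI)
  show "abelian_group (field_ring :: 'k ring)"
    by (rule abelian_groupI) (auto simp: field_ring_def algebra_simps intro: exI[of _ "- _"])
  show "Group.comm_monoid (field_ring :: 'k ring)"
    by (rule comm_monoidI) (auto simp: field_ring_def algebra_simps)
qed (auto simp: field_ring_def algebra_simps)

lemma affine_ind_variety_mono:
  assumes "affine_ind_variety X" "m \<le> k"
  shows "points (X m) \<subseteq> points (X k)"
  using lift_Suc_mono_le[of "\<lambda>k. points (X k)" m k] assms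
  by (simp add: affine_ind_variety_def)

lemma algebra_coordinate_ring:
  fixes X :: "nat \<Rightarrow> ('x, 'k::field) variety"
  assumes "affine_ind_variety X"
  shows "algebra field_ring (coordinate_ring X)"
proof -
  have aff: "affine_variety (X k)" for k
    using assms by (simp add: affine_ind_variety_def)
  note closed = affine_variety_regular_closed[OF aff]
  have mem: "s \<in> carrier (coordinate_ring X) \<longleftrightarrow> (\<forall>k. s k \<in> regular (X k)) \<and>
      (\<forall>k m. m \<le> k \<longrightarrow> restrict (s k) (points (X m)) = s m)" for s
    by (simp add: coordinate_ring_def inverse_limit_def regular_algebra_def)
  have ops: "s \<oplus>\<^bsub>coordinate_ring X\<^esub> t = (\<lambda>k. \<lambda>x\<in>points (X k). s k x + t k x)"
    "s \<otimes>\<^bsub>coordinate_ring X\<^esub> t = (\<lambda>k. \<lambda>x\<in>points (X k). s k x * t k x)"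
    "c \<odot>\<^bsub>coordinate_ring X\<^esub> s = (\<lambda>k. \<lambda>x\<in>points (X k). c * s k x)"
    "\<zero>\<^bsub>coordinate_ring X\<^esub> = (\<lambda>k. \<lambda>x\<in>points (X k). 0)"
    "\<one>\<^bsub>coordinate_ring X\<^esub> = (\<lambda>k. \<lambda>x\<in>points (X k). 1)" for s t c
    by (simp_all add: coordinate_ring_def inverse_limit_def regular_algebra_def)
  have ext: "s k x = undefined" if "s \<in> carrier (coordinate_ring X)" "x \<notin> points (X k)" for s k x
  proof -
    have "s k \<in> extensional (points (X k))"
      using that(1) aff[of k] unfolding mem affine_variety_def by blast
    with that(2) show ?thesis by (simp add: extensional_def)
  qed
  have compat: "s k x = s m x"
    if "s \<in> carrier (coordinate_ring X)" "m \<le> k" "x \<in> points (X m)" for s k m x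
  proof -
    have "restrict (s k) (points (X m)) = s m" using that mem by blast
    from fun_cong[OF this, of x] that(3) show ?thesis by simp
  qed
  have memI: "(\<lambda>k. \<lambda>x\<in>points (X k). u k x) \<in> carrier (coordinate_ring X)"
    if "\<And>k. (\<lambda>x\<in>points (X k). u k x) \<in> regular (X k)"
      and "\<And>k m x. \<lbrakk>m \<le> k; x \<in> points (X m)\<rbrakk> \<Longrightarrow> u k x = u m x" for u
    unfolding mem using that affine_ind_variety_mono[OF assms]
    by (auto simp: fun_eq_iff restrict_def subset_iff)
  have add_mem: "s \<oplus>\<^bsub>coordinate_ring X\<^esub> t \<in> carrier (coordinate_ring X)"
    if "s \<in> carrier (coordinate_ring X)" "t \<in> carrier (coordinate_ring X)" for s t
    unfolding ops using that
    by (intro memI closed(2)) (simp_all add: mem[of s] mem[of t] compat[OF that(1)] compat[OF that(2)])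
  have mult_mem: "s \<otimes>\<^bsub>coordinate_ring X\<^esub> t \<in> carrier (coordinate_ring X)"
    if "s \<in> carrier (coordinate_ring X)" "t \<in> carrier (coordinate_ring X)" for s t
    unfolding ops using that
    by (intro memI closed(3)) (simp_all add: mem[of s] mem[of t] compat[OF that(1)] compat[OF that(2)])
  have smult_mem: "c \<odot>\<^bsub>coordinate_ring X\<^esub> s \<in> carrier (coordinate_ring X)"
    if "s \<in> carrier (coordinate_ring X)" for s c
    unfolding ops using that by (intro memI closed(4)) (simp_all add: mem[of s] compat[OF that])
  have zero_mem: "\<zero>\<^bsub>coordinate_ring X\<^esub> \<in> carrier (coordinate_ring X)"
    and one_mem: "\<one>\<^bsub>coordinate_ring X\<^esub> \<in> carrier (coordinate_ring X)"
    unfolding ops by (rule memI; simp add: closed(1))+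
  have ab: "abelian_group (coordinate_ring X)"
  proof (rule abelian_groupI)
    fix s assume s: "s \<in> carrier (coordinate_ring X)"
    have "(-1) \<odot>\<^bsub>coordinate_ring X\<^esub> s \<oplus>\<^bsub>coordinate_ring X\<^esub> s = \<zero>\<^bsub>coordinate_ring X\<^esub>"
      by (auto simp: ops fun_eq_iff restrict_def)
    with smult_mem[OF s] show "\<exists>t\<in>carrier (coordinate_ring X).
        t \<oplus>\<^bsub>coordinate_ring X\<^esub> s = \<zero>\<^bsub>coordinate_ring X\<^esub>" by blast
  qed (auto simp: add_mem zero_mem, auto simp: ops ext fun_eq_iff restrict_def algebra_simps)
  have cm: "Group.comm_monoid (coordinate_ring X)"
    by (rule comm_monoidI)
      (auto simp: mult_mem one_mem, auto simp: ops ext fun_eq_iff restrict_def algebra_simps)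
  have cr: "cring (coordinate_ring X)"
    by (rule cringI[OF ab cm]) (auto simp: ops fun_eq_iff restrict_def algebra_simps)
  show ?thesis
  proof (rule algebraI[OF cring_field_ring cr])
    fix s assume s: "s \<in> carrier (coordinate_ring X)"
    show "c \<odot>\<^bsub>coordinate_ring X\<^esub> s \<in> carrier (coordinate_ring X)" for c
      by (rule smult_mem[OF s])
    show "\<one>\<^bsub>field_ring\<^esub> \<odot>\<^bsub>coordinate_ring X\<^esub> s = s"
      by (auto simp: ops field_ring_def fun_eq_iff restrict_def ext[OF s])
  qed (simp_all add: ops field_ring_def fun_eq_iff algebra_simps cong: if_cong)
qed

section \<open>Strictness and isomorphism\<close>

lemma affine_ind_variety_regular:
  assumes X: "affine_ind_variety X" and "m \<le> k"
  shows "regular (X m) = (\<lambda>g. restrict g (points (X m))) ` regular (X k)"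
  using \<open>m \<le> k\<close>
proof (induction k rule: dec_induct)
  case base
  have "restrict g (points (X m)) = g" if "g \<in> regular (X m)" for g
    using X that unfolding affine_ind_variety_def affine_variety_def
    by (meson extensional_restrict subset_iff)
  then show ?case by force
next
  case (step k)
  let ?P = "points (X k)" and ?S = "subvariety (X (Suc k)) (points (X k))"
  have ext: "regular (X k) \<subseteq> extensional ?P"
    using X by (simp add: affine_ind_variety_def affine_variety_def)
  have "isomorphism (X k) ?S (\<lambda>x. x)"
    using X by (simp add: affine_ind_variety_def closed_immersion_def)
  then have "\<forall>g\<in>regular ?S. restrict g ?P \<in> regular (X k)"
    and "\<forall>g\<in>regular (X k). restrict (\<lambda>x. g (inv_into ?P (\<lambda>x. x) x)) ?P \<in> regular ?S"
    by (auto simp: isomorphism_def morphism_def subvariety_def)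
  moreover have "restrict (\<lambda>x. g (inv_into ?P (\<lambda>x. x) x)) ?P = g" if "g \<in> regular (X k)" for g
  proof
    fix x
    have "inv_into ?P (\<lambda>x. x) x = x" if "x \<in> ?P"
      using that by (metis f_inv_into_f image_ident)
    then show "restrict (\<lambda>x. g (inv_into ?P (\<lambda>x. x) x)) ?P x = g x"
      using ext \<open>g \<in> regular (X k)\<close> by (auto simp: extensional_def restrict_def)
  qed
  ultimately have eq: "regular (X k) = (\<lambda>g. restrict g ?P) ` regular (X (Suc k))"
    by (auto simp: subvariety_def)
  have "points (X m) \<subseteq> ?P"
    using affine_ind_variety_mono[OF X step.hyps(1)] .
  then have "restrict (restrict g ?P) (points (X m)) = restrict g (points (X m))" for g :: "_ \<Rightarrow> 'b"
    by (auto simp: fun_eq_iff restrict_def)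
  then show ?case by (simp only: step.IH eq image_image)
qed

lemma affine_ind_variety_inclusion:
  assumes "affine_ind_variety X" "m \<le> k"
  shows "morphism (X m) (X k) (\<lambda>x. x)"
  using affine_ind_variety_mono[OF assms] affine_ind_variety_regular[OF assms]
  by (auto simp: morphism_def)

lemma affine_ind_variety_eqI:
  assumes X: "affine_ind_variety X" and "m \<le> k" and eq: "points (X m) = points (X k)"
  shows "X m = X k"
proof -
  have "restrict g (points (X k)) = g" if "g \<in> regular (X k)" for g
    using X that unfolding affine_ind_variety_def affine_variety_def
    by (meson extensional_restrict subset_iff)
  then have "regular (X m) = regular (X k)"
    using affine_ind_variety_regular[OF assms(1,2)] eq by force
  with eq show ?thesis by simp
qed

lemma morphism_ident: "affine_variety V \<Longrightarrow> morphism V V (\<lambda>x. x)"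
  by (auto simp: morphism_def affine_variety_def subset_iff extensional_restrict)

lemma morphism_trans:
  assumes f: "morphism U V f" and g: "morphism V W g"
  shows "morphism U W (\<lambda>x. g (f x))"
  unfolding morphism_def
proof (intro conjI ballI)
  show "(\<lambda>x. g (f x)) ` points U \<subseteq> points W"
    using f g by (auto simp: morphism_def)
  fix h assume "h \<in> regular W"
  then have "restrict (\<lambda>x. h (g x)) (points V) \<in> regular V"
    using g by (simp add: morphism_def)
  then have "restrict (\<lambda>x. restrict (\<lambda>x. h (g x)) (points V) (f x)) (points U) \<in> regular U"
    using f by (simp only: morphism_def)
  moreover have "restrict (\<lambda>x. restrict (\<lambda>x. h (g x)) (points V) (f x)) (points U)
      = restrict (\<lambda>x. h (g (f x))) (points U)"
    using f by (auto simp: morphism_def fun_eq_iff restrict_def)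
  ultimately show "restrict (\<lambda>x. h (g (f x))) (points U) \<in> regular U" by simp
qed

lemma morphism_cong:
  assumes "\<And>x. x \<in> points V \<Longrightarrow> f x = g x"
  shows "morphism V W f \<longleftrightarrow> morphism V W g"
proof -
  have "restrict (\<lambda>x. h (f x)) (points V) = restrict (\<lambda>x. h (g x)) (points V)" for h :: "_ \<Rightarrow> 'b"
    using assms by (auto simp: fun_eq_iff restrict_def)
  moreover have "f ` points V = g ` points V"
    using assms by (rule image_cong[OF refl])
  ultimately show ?thesis by (simp add: morphism_def)
qed

lemma ind_isomorphism_ident_iff:
  "ind_isomorphism X Y (\<lambda>x. x) \<longleftrightarrow> ind_points X = ind_points Y \<and>
     (\<forall>k. \<exists>l. morphism (X k) (Y l) (\<lambda>x. x)) \<and> (\<forall>k. \<exists>l. morphism (Y k) (X l) (\<lambda>x. x))"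
proof (cases "ind_points X = ind_points Y")
  case True
  have "inv_into (ind_points X) (\<lambda>x. x) x = x" if "x \<in> points (Y k)" for x k
  proof -
    have "x \<in> (\<lambda>x. x) ` ind_points X" using that True by (auto simp: ind_points_def)
    then show ?thesis by (rule f_inv_into_f)
  qed
  then have "morphism (Y k) (X l) (inv_into (ind_points X) (\<lambda>x. x)) \<longleftrightarrow>
      morphism (Y k) (X l) (\<lambda>x. x)" for k l
    by (intro morphism_cong)
  then show ?thesis
    using True by (simp add: ind_isomorphism_def ind_morphism_def bij_betw_def)
next
  case False
  then show ?thesis by (simp add: ind_isomorphism_def bij_betw_def)
qed

lemma affine_ind_variety_const:
  assumes V: "affine_variety V"
  shows "affine_ind_variety (\<lambda>_. V)"
proof -
  have "(\<lambda>g. restrict g (points V)) ` regular V = id ` regular V"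
    using V by (intro image_cong) (auto simp: affine_variety_def subset_iff extensional_restrict)
  then have sub: "subvariety V (points V) = V" by (simp add: subvariety_def)
  have "morphism V V (inv_into (points V) (\<lambda>x. x)) \<longleftrightarrow> morphism V V (\<lambda>x. x)"
    by (rule morphism_cong) (metis f_inv_into_f image_ident)
  then have "isomorphism V V (\<lambda>x. x)"
    using morphism_ident[OF V] by (simp add: isomorphism_def bij_betw_def)
  moreover have "zariski_closed V (points V)"
    unfolding zariski_closed_def by (rule exI[of _ "{}"]) (simp add: zero_locus_def)
  ultimately show ?thesis using V sub by (simp add: affine_ind_variety_def closed_immersion_def)
qed

lemma strict_not_isomorphic:
  fixes V :: "('y, 'k::field) variety"
  assumes X: "affine_ind_variety X" and "strict X"
  shows "\<not> ind_isomorphism X (\<lambda>_. V) f"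
proof
  assume iso: "ind_isomorphism X (\<lambda>_. V) f"
  let ?g = "inv_into (ind_points X) f"
  have "bij_betw f (ind_points X) (points V)"
    using iso by (simp add: ind_isomorphism_def ind_points_def)
  then have "?g ` points V = ind_points X"
    by (meson bij_betw_imp_surj_on bij_betw_inv_into)
  moreover obtain l where "?g ` points V \<subseteq> points (X l)"
    using iso by (auto simp: ind_isomorphism_def ind_morphism_def morphism_def)
  ultimately have l: "ind_points X = points (X l)"
    by (auto simp: ind_points_def)
  have aff: "affine_variety (X k)" for k
    using X by (simp add: affine_ind_variety_def)
  have "morphism (X k) (X l) (\<lambda>x. x)" for k
  proof (cases "k \<le> l")
    case True
    then show ?thesis by (rule affine_ind_variety_inclusion[OF X])
  next
    case False
    then have "points (X l) = points (X k)"
      using l affine_ind_variety_mono[OF X, of l k] by (auto simp: ind_points_def)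
    with False have "X l = X k" by (intro affine_ind_variety_eqI[OF X]) auto
    with morphism_ident[OF aff] show ?thesis by simp
  qed
  then have "equivalent_filtrations X (\<lambda>_. X l)"
    unfolding equivalent_filtrations_def ind_isomorphism_ident_iff
    using l morphism_ident[OF aff] by (auto simp: ind_points_def)
  with affine_ind_variety_const[OF aff] \<open>strict X\<close> show False
    unfolding strict_def by blast
qed

lemma not_strict_isomorphic:
  fixes X :: "nat \<Rightarrow> ('x, 'k::field) variety"
  assumes "\<not> strict X"
  shows "\<exists>(V :: ('x, 'k) variety) f. affine_variety V \<and> ind_isomorphism X (\<lambda>_. V) f"
proof -
  obtain Y N where Y: "affine_ind_variety Y" and N: "\<forall>k\<ge>N. Y k = Y N"
    and eq: "equivalent_filtrations X Y"
    using assms by (auto simp: strict_def)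
  have incl: "morphism (Y l) (Y N) (\<lambda>x. x)" for l
  proof -
    have "Y (max l N) = Y N" by (rule N[rule_format]) simp
    with affine_ind_variety_inclusion[OF Y, of l "max l N"] show ?thesis by simp
  qed
  then have "ind_points Y = points (Y N)"
    by (auto simp: ind_points_def morphism_def)
  then have "ind_points X = ind_points (\<lambda>_ :: nat. Y N)"
    using eq by (simp add: equivalent_filtrations_def ind_points_def)
  moreover have "morphism (X k) (Y N) (\<lambda>x. x)" for k
  proof -
    obtain l where "morphism (X k) (Y l) (\<lambda>x. x)"
      using eq unfolding equivalent_filtrations_def ind_isomorphism_ident_iff by blast
    then show ?thesis by (rule morphism_trans[OF _ incl])
  qed
  ultimately have "ind_isomorphism X (\<lambda>_. Y N) (\<lambda>x. x)"
    using eq unfolding equivalent_filtrations_def ind_isomorphism_ident_iff by blast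
  moreover have "affine_variety (Y N)" using Y by (simp add: affine_ind_variety_def)
  ultimately show ?thesis by blast
qed

end

theory Submission
  imports Defs "HOL-Library.Function_Algebras"
begin

text \<open>
  A strict affine ind-variety grows infinitely often, so there are points \<open>x\<^sub>0, x\<^sub>1, \<dots>\<close>, each lying
  in a later member of the filtration than all previous ones. Regular functions extend from a
  closed subvariety, and at a point outside it the extension can be given any value; hence
  evaluation at the points \<open>x\<^sub>j\<close> maps the coordinate ring onto the algebra \<open>\<K>\<^sup>\<nat>\<close> of all sequences.
  In \<open>\<K>\<^sup>\<nat>\<close> the ideals of sequences vanishing from index \<open>m\<close> on form a strictly ascending chain,
  and \<open>\<K>\<^sup>\<nat>\<close> does not have countable dimension, whereas a countably generated algebra is spanned
  by the countably many monomials in its generators.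
\<close>

section \<open>The algebra of sequences\<close>

interpretation seq: vector_space "\<lambda>(c :: 'k::field) (f :: nat \<Rightarrow> 'k) j. c * f j"
  by unfold_locales (auto simp: fun_eq_iff algebra_simps)

text \<open>Restricting to a block of indices is linear; filling up with zeros keeps the result in
  the same vector space.\<close>

lemma span_seq_restrict:
  fixes S :: "(nat \<Rightarrow> 'k::field) set"
  assumes "f \<in> seq.span S"
  shows "(\<lambda>j. if j \<in> B then f j else 0) \<in> seq.span ((\<lambda>f j. if j \<in> B then f j else 0) ` S)"
    (is "?r f \<in> seq.span (?r ` S)")
  using assms
proof (rule seq.span_induct)
  have add: "?r (f + g) = ?r f + ?r g" and scale: "?r (\<lambda>j. c * f j) = (\<lambda>j. c * ?r f j)"
    and zero: "?r 0 = 0" for f g :: "nat \<Rightarrow> 'k" and c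
    by (auto simp: fun_eq_iff)
  show "seq.subspace {f. ?r f \<in> seq.span (?r ` S)}"
    by (rule seq.subspaceI)
      (simp_all only: mem_Collect_eq add scale zero seq.span_zero seq.span_add seq.span_scale)
qed (auto intro: seq.span_base)

text \<open>Unit sequences are linearly independent, so a span of fewer than \<open>card J\<close>
  vectors cannot contain all of those with index in \<open>J\<close>.\<close>

lemma unit_sequence_not_in_span:
  fixes T :: "(nat \<Rightarrow> 'k::field) set"
  assumes "finite T" "card T < card J" "finite J"
  shows "\<exists>j\<in>J. (\<lambda>i. if i = j then 1 else 0) \<notin> seq.span T"
proof (rule ccontr)
  let ?u = "\<lambda>j i. if i = j then 1 else 0 :: 'k"
  assume "\<not> ?thesis"
  then have "?u ` J \<subseteq> seq.span T" by blast
  moreover have inj: "inj ?u"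
    by (rule injI) (metis one_neq_zero)
  moreover have "seq.independent (?u ` J)"
  proof (rule seq.independent_if_scalars_zero)
    fix c :: "(nat \<Rightarrow> 'k) \<Rightarrow> 'k" and u
    assume 0: "(\<Sum>u\<in>?u ` J. (\<lambda>i. c u * u i)) = 0" and "u \<in> ?u ` J"
    then obtain j where j: "j \<in> J" "u = ?u j" by blast
    have "0 = (\<Sum>u\<in>?u ` J. (\<lambda>i. c u * u i)) j" by (simp only: 0 zero_fun_def)
    also have "\<dots> = (\<Sum>u\<in>?u ` J. c u * u j)"
      by (induction rule: infinite_finite_induct) auto
    also have "\<dots> = (\<Sum>i\<in>J. c (?u i) * ?u i j)"
      by (rule sum.reindex_cong[OF inj_on_subset[OF inj subset_UNIV]]) auto
    also have "\<dots> = c u"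
      using j assms(3) by (simp add: if_distrib sum.delta cong: if_cong)
    finally show "c u = 0" by simp
  qed (use assms in simp)
  ultimately have "card (?u ` J) \<le> card T"
    using seq.independent_span_bound[OF assms(1)] by blast
  moreover have "card (?u ` J) = card J"
    using inj by (intro card_image) (auto intro: inj_on_subset)
  ultimately show False using assms(2) by simp
qed

text \<open>
  A diagonal argument over infinitely many disjoint infinite blocks of indices: on the \<open>m\<close>-th
  block \<open>f\<close> is a unit sequence avoiding the span of the first \<open>m\<close> vectors restricted to it.
\<close>

lemma span_seq_countable:
  fixes P :: "(nat \<Rightarrow> 'k::field) set"
  assumes "countable P"
  shows "seq.span P \<noteq> UNIV"
proof
  assume all: "seq.span P = UNIV"
  \<comment> \<open>Inserting \<open>0\<close> lets an empty \<open>P\<close> be enumerated as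
    well.\<close>
  define v where "v = from_nat_into (insert 0 P)"
  have v: "range v = insert 0 P" using assms by (simp add: v_def)
  \<comment> \<open>The rows of the pairing function are infinite and pairwise disjoint.\<close>
  define B where "B m = range (\<lambda>i. prod_encode (m, i))" for m
  let ?r = "\<lambda>m f j. if j \<in> B m then f j else 0 :: 'k"
  let ?u = "\<lambda>j i. if i = j then 1 else 0 :: 'k"
  have "\<exists>j\<in>B m. ?u j \<notin> seq.span (?r m ` v ` {..<m})" for m
  proof -
    \<comment> \<open>On the block, \<open>m + 1\<close> unit sequences already outnumber the at
      most \<open>m\<close> restricted vectors.\<close>
    let ?J = "(\<lambda>i. prod_encode (m, i)) ` {..m}"
    have "card ?J = Suc m"
      by (subst card_image) (auto simp: inj_on_def)
    moreover have "card (?r m ` v ` {..<m}) \<le> m"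
      by (metis card_image_le card_lessThan finite_imageI finite_lessThan le_trans)
    ultimately have "\<exists>j\<in>?J. ?u j \<notin> seq.span (?r m ` v ` {..<m})"
      by (intro unit_sequence_not_in_span) auto
    then show ?thesis by (auto simp: B_def)
  qed
  then have "\<forall>m. \<exists>j. j \<in> B m \<and> ?u j \<notin> seq.span (?r m ` v ` {..<m})" by blast
  from choice[OF this] obtain e
    where e: "e m \<in> B m" "?u (e m) \<notin> seq.span (?r m ` v ` {..<m})" for m
    by blast
  define f :: "nat \<Rightarrow> 'k" where "f j = (if j \<in> range e then 1 else 0)" for j
  have "f \<in> seq.span P" using all by simp
  then obtain t c where t: "finite t" "t \<subseteq> P" and f: "f = (\<Sum>a\<in>t. (\<lambda>j. c a * a j))"
    unfolding seq.span_explicit by blast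
  have "f \<in> seq.span t"
    unfolding f by (intro seq.span_sum seq.span_scale seq.span_base)
  \<comment> \<open>A finite combination uses only the first \<open>m\<close> vectors for some
    \<open>m\<close>, and block \<open>m\<close> was built against exactly these.\<close>
  moreover obtain m where "t \<subseteq> v ` {..<m}"
  proof -
    obtain C where C: "finite C" "t = v ` C"
      using t v finite_subset_image[of t v UNIV] by auto
    then obtain m where "C \<subseteq> {..<m}" using finite_nat_iff_bounded by blast
    with C that show ?thesis by blast
  qed
  ultimately have "f \<in> seq.span (v ` {..<m})"
    using seq.span_mono by blast
  then have "?r m f \<in> seq.span (?r m ` v ` {..<m})" by (rule span_seq_restrict)
  moreover have "?r m f = ?u (e m)"
  proof
    fix j
    \<comment> \<open>The blocks being disjoint, \<open>e m\<close> is the only index in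
      \<open>B m\<close> at which \<open>f\<close> is nonzero.\<close>
    have "k = m" if "e k \<in> B m" for k
      using that e(1)[of k] by (auto simp: B_def)
    then show "?r m f j = ?u (e m) j" using e(1)[of m] by (auto simp: f_def)
  qed
  ultimately show False using e(2) by simp
qed

text \<open>Multiplication is bilinear, so closure passes from \<open>P\<close> to its span by one
  induction in each factor.\<close>

lemma span_seq_mult:
  fixes P :: "(nat \<Rightarrow> 'k::field) set"
  assumes P: "\<And>p q. \<lbrakk>p \<in> P; q \<in> P\<rbrakk> \<Longrightarrow> p * q \<in> P"
    and f: "f \<in> seq.span P" and g: "g \<in> seq.span P"
  shows "f * g \<in> seq.span P"
  using f
proof (rule seq.span_induct)
  show "seq.subspace {f. f * g \<in> seq.span P}"
  proof (rule seq.subspaceI)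
    fix f h assume "f \<in> {f. f * g \<in> seq.span P}" "h \<in> {f. f * g \<in> seq.span P}"
    then show "f + h \<in> {f. f * g \<in> seq.span P}"
      by (simp add: distrib_right seq.span_add)
  next
    fix f c assume "f \<in> {f. f * g \<in> seq.span P}"
    then have "(\<lambda>j. c * (f * g) j) \<in> seq.span P" by (simp only: mem_Collect_eq seq.span_scale)
    then show "(\<lambda>j. c * f j) \<in> {f. f * g \<in> seq.span P}"
      by (simp add: times_fun_def mult.assoc)
  qed (simp add: seq.span_zero)
next
  fix p assume p: "p \<in> P"
  from g have "p * g \<in> seq.span P"
  proof (rule seq.span_induct)
    show "seq.subspace {g. p * g \<in> seq.span P}"
    proof (rule seq.subspaceI)
      fix f h assume "f \<in> {g. p * g \<in> seq.span P}" "h \<in> {g. p * g \<in> seq.span P}"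
      then show "f + h \<in> {g. p * g \<in> seq.span P}"
        by (simp add: distrib_left seq.span_add)
    next
      fix f c assume "f \<in> {g. p * g \<in> seq.span P}"
      then have "(\<lambda>j. c * (p * f) j) \<in> seq.span P" by (simp only: mem_Collect_eq seq.span_scale)
      then show "(\<lambda>j. c * f j) \<in> {g. p * g \<in> seq.span P}"
        by (simp add: times_fun_def mult.left_commute)
    qed (simp add: seq.span_zero)
  qed (rule seq.span_base[OF P[OF p]])
  then show "p * g \<in> seq.span P" .
qed

section \<open>Algebras that map onto the algebra of sequences\<close>

lemma not_noetherian_if_onto_seq:
  fixes R (structure) and E :: "'a \<Rightarrow> nat \<Rightarrow> 'k::field"
  assumes add: "\<And>a b. E (a \<oplus> b) = E a + E b"
    and mult: "\<And>a b. E (a \<otimes> b) = E a * E b"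
    and onto: "E ` carrier R = UNIV"
  shows "\<not> noetherian_ring R"
proof
  assume "noetherian_ring R"
  then interpret noetherian_ring R .
  have zero: "E \<zero> = 0"
    using add[of \<zero> \<zero>] by simp
  have neg: "E (\<ominus> a) = - E a" if "a \<in> carrier R" for a
    using add[of a "\<ominus> a"] that by (simp add: r_neg zero eq_neg_iff_add_eq_0 add.commute)
  \<comment> \<open>These are the preimages under \<open>E\<close> of the ideals in the chain.
    Noetherianity makes their union one of them, say \<open>J m\<close>; a preimage of the unit
    sequence at \<open>m\<close> then lies in \<open>J (Suc m)\<close> but not in
    \<open>J m\<close>.\<close>
  define J where "J m = {a \<in> carrier R. \<forall>j\<ge>m. E a j = 0}" for m :: nat
  have "ideal (J m) R" for m
  proof (rule idealI)
    show "subgroup (J m) (add_monoid R)"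
      by (rule add.subgroupI) (auto simp: J_def add zero neg simp flip: a_inv_def)
  qed (auto simp: J_def mult ring_axioms)
  moreover have "J m \<subseteq> J n" if "m \<le> n" for m n
    using that by (auto simp: J_def)
  then have "J m \<subseteq> J n \<or> J n \<subseteq> J m" for m n
    using nat_le_linear by blast
  ultimately have "subset.chain {I. ideal I R} (range J)"
    unfolding subset_chain_def by blast
  then have "\<Union> (range J) \<in> range J"
    by (intro ideal_chain_is_trivial) auto
  then obtain m where m: "\<Union> (range J) = J m" by blast
  obtain a where "a \<in> carrier R" "E a = (\<lambda>j. if j = m then 1 else 0)"
    using onto by (metis UNIV_I imageE)
  then have "a \<in> J (Suc m)" "a \<notin> J m" by (auto simp: J_def)
  with m show False by blast
qed

lemma not_countably_generated_if_onto_seq: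
  fixes R :: "('k::field, 'a) module" (structure) and E :: "'a \<Rightarrow> nat \<Rightarrow> 'k"
  assumes one: "E \<one> = 1"
    and add: "\<And>a b. E (a \<oplus> b) = E a + E b"
    and mult: "\<And>a b. E (a \<otimes> b) = E a * E b"
    and smult: "\<And>c a. E (c \<odot>\<^bsub>R\<^esub> a) = (\<lambda>j. c * E a j)"
    and onto: "E ` carrier R = UNIV"
  shows "\<not> countably_generated_algebra R"
proof
  assume "countably_generated_algebra R"
  then obtain S where S: "countable S" "generated_subalgebra R S = carrier R"
    by (auto simp: countably_generated_algebra_def)
  \<comment> \<open>The monomials in the images of the generators: the empty list gives
    \<open>1\<close>, and appending lists gives closure under products.\<close>
  define P where "P = prod_list ` lists (E ` S)"
  have "countable P" using S by (simp add: P_def)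
  have closed: "p * q \<in> P" if pq: "p \<in> P" "q \<in> P" for p q
  proof -
    obtain k l where "k \<in> lists (E ` S)" "l \<in> lists (E ` S)" "p = prod_list k" "q = prod_list l"
      using pq by (auto simp: P_def)
    then show ?thesis unfolding P_def by (intro image_eqI[of _ _ "k @ l"]) auto
  qed
  have "E a \<in> seq.span P" if "a \<in> generated_subalgebra R S" for a
    using that
  proof induction
    case one
    have "1 \<in> P" unfolding P_def by (rule image_eqI[of _ _ "[]"]) auto
    then show ?case unfolding assms(1) by (rule seq.span_base)
  next
    case (incl s)
    then have "E s \<in> P" unfolding P_def by (intro image_eqI[of _ _ "[E s]"]) auto
    then show ?case by (rule seq.span_base)
  next
    case (add a b)
    then show ?case by (simp only: assms(2) seq.span_add)
  next
    case (mult a b)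
    then show ?case by (simp only: assms(3) span_seq_mult[OF closed])
  next
    case (smult a c)
    then show ?case by (simp only: assms(4) seq.span_scale)
  qed
  then have "E ` carrier R \<subseteq> seq.span P" using S by blast
  then show False using onto span_seq_countable[OF \<open>countable P\<close>] by blast
qed

section \<open>Interpolation on an affine ind-variety\<close>

text \<open>Take any extension \<open>g\<close> of \<open>f\<close> and correct its value at
  \<open>x\<close> by a multiple of an equation \<open>h\<close> of the closed subset
  \<open>points (X k)\<close> with \<open>h x\<close> nonzero.\<close>

lemma regular_extension:
  assumes X: "affine_ind_variety X" and f: "f \<in> regular (X k)"
    and x: "x \<in> points (X (Suc k)) - points (X k)"
  shows "\<exists>g\<in>regular (X (Suc k)). restrict g (points (X k)) = f \<and> g x = c"
proof -
  let ?V = "X (Suc k)"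
  have V: "affine_variety ?V" and sub: "points (X k) \<subseteq> points ?V"
    and "closed_immersion (X k) ?V (\<lambda>x. x)"
    using X by (auto simp: affine_ind_variety_def)
  then obtain F where F: "F \<subseteq> regular ?V" "points (X k) = zero_locus ?V F"
    by (auto simp: closed_immersion_def zariski_closed_def)
  with x obtain h where h: "h \<in> F" "h x \<noteq> 0"
    by (auto simp: zero_locus_def)
  obtain g where g: "g \<in> regular ?V" "f = restrict g (points (X k))"
    using f affine_ind_variety_regular[OF X, of k "Suc k"] by auto
  let ?g = "\<lambda>y\<in>points ?V. g y + (\<lambda>y\<in>points ?V. ((c - g x) / h x) * h y) y"
  have "?g \<in> regular ?V"
    using g h F by (intro affine_variety_regular_closed[OF V]) auto
  moreover have "restrict ?g (points (X k)) = f"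
    using F h by (auto simp: g fun_eq_iff restrict_def zero_locus_def)
  moreover have "?g x = c" using x h by simp
  ultimately show ?thesis by blast
qed

text \<open>The compatible family is built stage by stage. As \<open>x k\<close> is new at stage
  \<open>Suc k\<close>, its value can be prescribed there without changing earlier choices.\<close>

lemma interpolation:
  assumes X: "affine_ind_variety X"
    and x: "\<And>k. k \<in> D \<Longrightarrow> x k \<in> points (X (Suc k)) - points (X k)"
  shows "\<exists>s\<in>carrier (coordinate_ring X). \<forall>k\<in>D. s (Suc k) (x k) = c k"
proof -
  have "\<exists>s. \<forall>k. s k \<in> regular (X k) \<and>
      restrict (s (Suc k)) (points (X k)) = s k \<and> (k \<in> D \<longrightarrow> s (Suc k) (x k) = c k)"
  proof (rule dependent_nat_choice)
    show "\<exists>f. f \<in> regular (X 0)"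
      using X affine_variety_regular_closed(1) by (auto simp: affine_ind_variety_def)
    fix f k assume f: "f \<in> regular (X k)"
    show "\<exists>g. g \<in> regular (X (Suc k)) \<and>
        restrict g (points (X k)) = f \<and> (k \<in> D \<longrightarrow> g (x k) = c k)"
    proof (cases "k \<in> D")
      case True
      then show ?thesis using regular_extension[OF X f x] by blast
    next
      case False
      then show ?thesis using f affine_ind_variety_regular[OF X, of k "Suc k"] by auto
    qed
  qed
  then obtain s where s: "\<And>k. s k \<in> regular (X k)"
      "\<And>k. restrict (s (Suc k)) (points (X k)) = s k" "\<And>k. k \<in> D \<Longrightarrow> s (Suc k) (x k) = c k"
    by blast
  have "restrict (s k) (points (X m)) = s m" if "m \<le> k" for k m
    using that
  proof (induction k rule: dec_induct)
    case base
    have "s m \<in> extensional (points (X m))" using s(2)[of m] by (metis restrict_extensional)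
    then show ?case by (rule extensional_restrict)
  next
    case (step k)
    have "restrict (s (Suc k)) (points (X m)) = restrict (s k) (points (X m))"
      using affine_ind_variety_mono[OF X step.hyps(1)] s(2)[of k]
      by (auto simp: fun_eq_iff restrict_def subset_iff) metis
    with step.IH show ?case by simp
  qed
  then have "s \<in> carrier (coordinate_ring X)"
    using s(1) by (simp add: coordinate_ring_def inverse_limit_def regular_algebra_def)
  with s(3) show ?thesis by blast
qed

text \<open>Within the filtration, equal point sets force equal varieties. With finitely many growth
  steps \<open>X\<close> would itself be an eventually constant filtration.\<close>

lemma strict_infinite_growth:
  assumes X: "affine_ind_variety X" and "strict X"
  shows "infinite {k. \<not> points (X (Suc k)) \<subseteq> points (X k)}" (is "infinite ?D")
proof
  assume "finite ?D"
  then obtain N where N: "?D \<subseteq> {..<N}"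
    unfolding finite_nat_iff_bounded ..
  have "points (X k) = points (X N)" if "N \<le> k" for k
    using that
  proof (induction k rule: dec_induct)
    case (step k)
    have "k \<notin> ?D" using N step.hyps(1) by (meson lessThan_iff not_less subsetD)
    with step.IH affine_ind_variety_mono[OF X, of k "Suc k"] show ?case by auto
  qed simp
  then have "\<forall>k\<ge>N. X k = X N"
    using affine_ind_variety_eqI[OF X] by metis
  moreover have "equivalent_filtrations X X"
    using X morphism_ident
    unfolding equivalent_filtrations_def ind_isomorphism_ident_iff affine_ind_variety_def by blast
  ultimately show False using X \<open>strict X\<close> unfolding strict_def by blast
qed

theorem theorem1:
  fixes X :: "nat \<Rightarrow> ('x, 'k :: {alg_closed_field, field_char_0}) variety"
  assumes "affine_ind_variety X"
    and "strict X"
  shows "\<not> noetherian_ring (coordinate_ring X) \<and>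
         \<not> countably_generated_algebra (coordinate_ring X)"
proof -
  let ?R = "coordinate_ring X"
  define D where "D = {k. \<not> points (X (Suc k)) \<subseteq> points (X k)}"
  have "\<forall>k\<in>D. \<exists>x. x \<in> points (X (Suc k)) - points (X k)"
    by (auto simp: D_def)
  from bchoice[OF this] obtain x
    where x: "x k \<in> points (X (Suc k)) - points (X k)" if "k \<in> D" for k
    by blast
  have "infinite D" unfolding D_def using assms by (rule strict_infinite_growth)
  define e where "e = enumerate D"
  have e: "e j \<in> D" "inj e" for j
    using \<open>infinite D\<close> by (auto simp: e_def enumerate_in_set strict_mono_enumerate
        intro: strict_mono_imp_inj_on)
  \<comment> \<open>Each point is evaluated at the first stage containing it; later stages give the
    same value for members of the inverse limit.\<close>
  define E where "E s j = s (Suc (e j)) (x (e j))" for s :: "nat \<Rightarrow> 'x \<Rightarrow> 'k" and j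
  have p: "x (e j) \<in> points (X (Suc (e j)))" for j using x[OF e(1)] by blast
  have one: "E \<one>\<^bsub>?R\<^esub> = 1"
    and add: "E (a \<oplus>\<^bsub>?R\<^esub> b) = E a + E b"
    and mult: "E (a \<otimes>\<^bsub>?R\<^esub> b) = E a * E b"
    and smult: "E (c \<odot>\<^bsub>?R\<^esub> a) = (\<lambda>j. c * E a j)" for a b c
    by (simp_all add: E_def p fun_eq_iff coordinate_ring_def inverse_limit_def regular_algebra_def)
  have "\<exists>s\<in>carrier ?R. E s = c" for c
  proof -
    \<comment> \<open>Injectivity of \<open>e\<close> lets the values \<open>c j\<close> be assigned
      to the growth steps \<open>e j\<close>.\<close>
    obtain s where "s \<in> carrier ?R" "\<forall>k\<in>D. s (Suc k) (x k) = c (inv_into UNIV e k)"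
      using interpolation[OF assms(1) x, of D "\<lambda>k. c (inv_into UNIV e k)"] by blast
    then show ?thesis using e by (intro bexI[of _ s]) (auto simp: E_def fun_eq_iff)
  qed
  then have onto: "E ` carrier ?R = UNIV" by (metis UNIV_eq_I image_eqI)
  show ?thesis
    using not_noetherian_if_onto_seq[OF add mult onto]
      not_countably_generated_if_onto_seq[OF one add mult smult onto] by blast
qed

end
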